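(* Let $A\in M_N(\mathbb{C})$ be a constant matrix, let $v(x)$ be a scalar polynomial of degree $k$, and let $\mathcal{D}=\partial_x+A$ and $\mathcal{D}^\dagger=-\mathcal{D}+v'(x)$ be the corresponding differential operators acting from the right on $M_N(\mathbb{C})$-valued functions. Then $\mathcal{D}$ and $\mathcal{D}^\dagger$ generate (under the commutator bracket) a Lie algebra $\mathfrak{g}$ of dimension $k+1$.
   Context: Differential operators act from the right: $F\cdot(\partial_x+A)=F'+FA$, and scalar functions act by multiplication; the product of operators is defined by $F\cdot(\mathcal{D}_1\mathcal{D}_2)=(F\cdot\mathcal{D}_1)\cdot\mathcal{D}_2$, and $[\mathcal{D}_1,\mathcal{D}_2]=\mathcal{D}_1\mathcal{D}_2-\mathcal{D}_2\mathcal{D}_1$. *)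

theory Defs
  imports "HOL-Analysis.Analysis" "HOL-Library.Function_Algebras"
begin

section \<open>Smooth matrix-valued functions\<close>

text \<open>The index type \<open>'n\<close> is finite and nonempty, so \<open>complex^'n^'n\<close> is the space of complex
  \<open>N \<times> N\<close> matrices with \<open>N = CARD('n) \<ge> 1\<close> arbitrary. Functions depend on a real variable;
  sums and differences of functions (and below of operators) are pointwise.\<close>

type_synonym 'n mfun = "real \<Rightarrow> complex^'n^'n"

definition cmat_scale :: "complex \<Rightarrow> complex^'n^'n \<Rightarrow> complex^'n^'n" where
  "cmat_scale c M = (\<chi> i j. c * M $ i $ j)"

definition mderiv :: "('n::finite) mfun \<Rightarrow> 'n mfun" where
  "mderiv F = (\<lambda>x. vector_derivative F (at x))"

definition smooth :: "('n::finite) mfun \<Rightarrow> bool" where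
  "smooth F \<longleftrightarrow> (\<forall>n x. (mderiv ^^ n) F differentiable (at x))"


section \<open>Operators acting from the right\<close>

text \<open>\<open>T F\<close> stands for \<open>F \<cdot> T\<close>. An operator is a linear endomorphism of the space of smooth
  functions. As HOL functions are total, it is represented by its extension by \<open>0\<close> to the
  non-smooth functions; hence two operators are equal iff they agree on all smooth functions.\<close>

type_synonym 'n mop = "'n mfun \<Rightarrow> 'n mfun"

definition linear_operators :: "('n::finite) mop set" where
  "linear_operators = {T.
     (\<forall>F. smooth F \<longrightarrow> smooth (T F)) \<and>
     (\<forall>F. \<not> smooth F \<longrightarrow> T F = 0) \<and>
     (\<forall>F G. smooth F \<longrightarrow> smooth G \<longrightarrow> T (F + G) = T F + T G) \<and>
     (\<forall>c F. smooth F \<longrightarrow> T (\<lambda>x. cmat_scale c (F x)) = (\<lambda>x. cmat_scale c (T F x)))}"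

text \<open>\<open>F \<cdot> (\<partial>\<^sub>x + A) = F' + F A\<close>\<close>

definition D_op :: "complex^'n^'n \<Rightarrow> ('n::finite) mop" where
  "D_op A F = (if smooth F then (\<lambda>x. mderiv F x + F x ** A) else 0)"

definition poly_op :: "complex poly \<Rightarrow> ('n::finite) mop" where
  "poly_op p F = (if smooth F then (\<lambda>x. cmat_scale (poly p (of_real x)) (F x)) else 0)"

definition D_dagger :: "complex^'n^'n \<Rightarrow> complex poly \<Rightarrow> ('n::finite) mop" where
  "D_dagger A v = - D_op A + poly_op (pderiv v)"

text \<open>\<open>F \<cdot> (T\<^sub>1 T\<^sub>2) = (F \<cdot> T\<^sub>1) \<cdot> T\<^sub>2\<close>, so products are compositions in reverse order.\<close>

definition op_prod :: "('n::finite) mop \<Rightarrow> 'n mop \<Rightarrow> 'n mop" where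
  "op_prod T\<^sub>1 T\<^sub>2 = (\<lambda>F. T\<^sub>2 (T\<^sub>1 F))"

definition commutator :: "('n::finite) mop \<Rightarrow> 'n mop \<Rightarrow> 'n mop" where
  "commutator T\<^sub>1 T\<^sub>2 = op_prod T\<^sub>1 T\<^sub>2 - op_prod T\<^sub>2 T\<^sub>1"


section \<open>The Lie algebra generated by a set of operators\<close>

definition op_scale :: "complex \<Rightarrow> ('n::finite) mop \<Rightarrow> 'n mop" where
  "op_scale c T = (\<lambda>F x. cmat_scale c (T F x))"

global_interpretation mop: vector_space "op_scale :: complex \<Rightarrow> ('n::finite) mop \<Rightarrow> 'n mop"
  defines mop_subspace = mop.subspace
      and mop_span = mop.span
      and mop_dependent = mop.dependent
      and mop_dim = mop.dim
      and mop_representation = mop.representation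
      and mop_extend_basis = mop.extend_basis
  by standard
    (simp_all add: op_scale_def cmat_scale_def fun_eq_iff vec_eq_iff algebra_simps)

text \<open>Lie subalgebras, over the complex numbers, of the associative algebra of operators
  with bracket the commutator.\<close>

definition lie_subalgebra :: "('n::finite) mop set \<Rightarrow> bool" where
  "lie_subalgebra L \<longleftrightarrow> L \<subseteq> linear_operators \<and> mop_subspace L \<and>
     (\<forall>S\<in>L. \<forall>T\<in>L. commutator S T \<in> L)"

definition lie_generated :: "('n::finite) mop set \<Rightarrow> 'n mop set" where
  "lie_generated S = \<Inter> {L. lie_subalgebra L \<and> S \<subseteq> L}"


section \<open>The commutator is a Lie bracket on the operators\<close>

lemma linear_cmat_scale: "linear (cmat_scale c :: complex^'n^'n \<Rightarrow> complex^('n::finite)^'n)"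
  by (rule linearI) (simp_all add: cmat_scale_def vec_eq_iff algebra_simps scaleR_conv_of_real)

lemma bl_cmat_scale: "bounded_linear (cmat_scale c :: complex^'n^'n \<Rightarrow> complex^('n::finite)^'n)"
  using linear_cmat_scale linear_conv_bounded_linear by blast

lemma mderiv_add:
  assumes "\<And>x. F differentiable (at x)" "\<And>x. G differentiable (at x)"
  shows "mderiv (\<lambda>x. F x + G x) = (\<lambda>x. mderiv F x + mderiv G x)"
  using assms unfolding mderiv_def
  by (intro ext vector_derivative_at has_vector_derivative_add)
     (simp_all add: vector_derivative_works)

lemma mderiv_scale:
  assumes "\<And>x. F differentiable (at x)"
  shows "mderiv (\<lambda>x. cmat_scale c (F x)) = (\<lambda>x. cmat_scale c (mderiv F x))"
  using assms unfolding mderiv_def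
  by (intro ext vector_derivative_at bounded_linear.has_vector_derivative[OF bl_cmat_scale])
     (simp add: vector_derivative_works)

lemma smooth_add:
  assumes "smooth F" "smooth G" shows "smooth (F + G)"
proof -
  have diff: "(mderiv ^^ n) F differentiable (at x)" "(mderiv ^^ n) G differentiable (at x)" for n x
    using assms by (auto simp: smooth_def)
  have "(mderiv ^^ n) (\<lambda>x. F x + G x) = (\<lambda>x. (mderiv ^^ n) F x + (mderiv ^^ n) G x)" for n
    by (induction n) (simp_all add: mderiv_add diff)
  with diff show ?thesis
    by (simp add: smooth_def plus_fun_def)
qed

lemma smooth_scale:
  assumes "smooth F" shows "smooth (\<lambda>x. cmat_scale c (F x))"
proof -
  have diff: "(mderiv ^^ n) F differentiable (at x)" for n x
    using assms by (auto simp: smooth_def)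
  have "(mderiv ^^ n) (\<lambda>x. cmat_scale c (F x)) = (\<lambda>x. cmat_scale c ((mderiv ^^ n) F x))" for n
    by (induction n) (simp_all add: mderiv_scale diff)
  moreover have "(\<lambda>y. cmat_scale c ((mderiv ^^ n) F y)) differentiable (at x)" for n x
    using diff[of n x] bounded_linear.has_derivative[OF bl_cmat_scale]
    unfolding differentiable_def by blast
  ultimately show ?thesis by (simp add: smooth_def)
qed

lemma smooth_zero: "smooth (0 :: ('n::finite) mfun)"
proof -
  have "(mderiv ^^ n) (0 :: 'n mfun) = 0" for n
    by (induction n) (simp_all add: mderiv_def zero_fun_def)
  then show ?thesis by (simp add: smooth_def zero_fun_def)
qed

lemma smooth_minus:
  assumes "smooth F" "smooth G" shows "smooth (F - G)"
proof -
  have "F - G = F + (\<lambda>x. cmat_scale (-1) (G x))"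
    by (simp add: fun_eq_iff cmat_scale_def vec_eq_iff)
  then show ?thesis using assms smooth_add smooth_scale by metis
qed

lemma linear_operatorsD:
  assumes "T \<in> linear_operators"
  shows "smooth (T F)" "\<not> smooth F \<Longrightarrow> T F = 0"
    "smooth F \<Longrightarrow> smooth G \<Longrightarrow> T (F + G) = T F + T G"
    "smooth F \<Longrightarrow> smooth G \<Longrightarrow> T (F - G) = T F - T G"
    "smooth F \<Longrightarrow> T (\<lambda>x. cmat_scale c (F x)) = (\<lambda>x. cmat_scale c (T F x))"
    "T 0 = 0"
proof -
  show *: "smooth (T F)" "\<not> smooth F \<Longrightarrow> T F = 0"
    using assms smooth_zero by (cases "smooth F"; auto simp: linear_operators_def)+
  show add: "smooth F \<Longrightarrow> smooth G \<Longrightarrow> T (F + G) = T F + T G" for F G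
    using assms by (auto simp: linear_operators_def)
  show "smooth F \<Longrightarrow> T (\<lambda>x. cmat_scale c (F x)) = (\<lambda>x. cmat_scale c (T F x))"
    using assms by (auto simp: linear_operators_def)
  show "smooth F \<Longrightarrow> smooth G \<Longrightarrow> T (F - G) = T F - T G"
    using add[of "F - G" G] smooth_minus[of F G] by (simp add: algebra_simps)
  show "T 0 = 0" using add[OF smooth_zero smooth_zero] by simp
qed

lemma commutator_closed:
  assumes "S \<in> linear_operators" "T \<in> linear_operators"
  shows "commutator S T \<in> linear_operators"
proof -
  note S = linear_operatorsD[OF assms(1)] and T = linear_operatorsD[OF assms(2)]
  have scale: "(\<lambda>x. cmat_scale c (F x)) - (\<lambda>x. cmat_scale c (G x)) = (\<lambda>x. cmat_scale c ((F - G) x))"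
    for c and F G :: "'a mfun"
    by (simp add: fun_eq_iff cmat_scale_def vec_eq_iff algebra_simps)
  show ?thesis
    unfolding linear_operators_def commutator_def op_prod_def
    using S T by (auto simp: smooth_minus scale)
qed

lemma commutator_self: "commutator T T = 0"
  by (simp add: commutator_def)

lemma commutator_antisym: "commutator S T = - commutator T S"
  by (simp add: commutator_def)

lemma commutator_add_left:
  assumes "R \<in> linear_operators" "S \<in> linear_operators" "T \<in> linear_operators"
  shows "commutator (R + S) T = commutator R T + commutator S T"
  using linear_operatorsD[OF assms(1)] linear_operatorsD[OF assms(2)] linear_operatorsD[OF assms(3)]
  by (auto simp: commutator_def op_prod_def fun_eq_iff)

lemma commutator_scale_left:
  assumes "S \<in> linear_operators" "T \<in> linear_operators"
  shows "commutator (op_scale c S) T = op_scale c (commutator S T)"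
proof
  fix F
  show "commutator (op_scale c S) T F = op_scale c (commutator S T) F"
    using linear_operatorsD[OF assms(1)] linear_operatorsD[OF assms(2)]
    by (auto simp: commutator_def op_prod_def op_scale_def cmat_scale_def fun_eq_iff vec_eq_iff
        algebra_simps)
qed

lemma commutator_jacobi:
  assumes "R \<in> linear_operators" "S \<in> linear_operators" "T \<in> linear_operators"
  shows "commutator R (commutator S T) + commutator S (commutator T R)
           + commutator T (commutator R S) = 0"
  using linear_operatorsD[OF assms(1)] linear_operatorsD[OF assms(2)] linear_operatorsD[OF assms(3)]
  by (auto simp: commutator_def op_prod_def fun_eq_iff)

end

theory Submission
  imports Defs
begin

text \<open>
  The product rule gives \<open>[\<D>, p] = - p'\<close> for every polynomial \<open>p\<close>, acting by multiplication, and
  multiplication operators commute with each other. Hence the operators \<open>c \<D> + p\<close> with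
  \<open>p\<close> in the space \<open>P\<^sub>k\<close> of polynomials of degree less than \<open>k\<close> form a Lie algebra, and it
  contains \<open>\<D>\<close> and \<open>\<D>\<^sup>\<dagger> = - \<D> + v'\<close>.

  Conversely, a Lie algebra containing \<open>\<D>\<close> and \<open>\<D>\<^sup>\<dagger>\<close> contains \<open>v' = \<D> + \<D>\<^sup>\<dagger>\<close>, and by repeated
  bracketing with \<open>\<D>\<close> all higher derivatives of \<open>v\<close>. If \<open>k > 0\<close>, then \<open>v', v'', \<dots>, v\<^bsup>(k)\<^esup>\<close> have
  degrees \<open>k - 1, k - 2, \<dots>, 0\<close>, as the characteristic is zero, so they span \<open>P\<^sub>k\<close>
  (\<open>mem_if_pderiv_closed\<close>). Therefore the generated Lie algebra is exactly \<open>\<complex> \<D> + P\<^sub>k\<close>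
  (\<open>lie_generated_eq\<close>); for \<open>k = 0\<close> both sides are \<open>\<complex> \<D>\<close>.

  The dimension is \<open>k + 1\<close> because the sum is direct and a polynomial is determined by
  its multiplication operator: if \<open>c \<D> + p = 0\<close>, then applying it to the identity matrix
  \<open>I\<close> and to \<open>x I\<close> yields \<open>c A + p(x) I = 0\<close> and \<open>c (I + x A) + x p(x) I = 0\<close>, whence \<open>c = 0\<close>, and
  \<open>p\<close> vanishes on the real line (\<open>D_op_poly_op_independent\<close>).
\<close>

section \<open>Smooth matrix functions\<close>

text \<open>Smoothness of a new function is shown by exhibiting a class of differentiable functions
  that contains it and is stable under differentiation; this avoids closed formulas for the
  higher derivatives.\<close>

lemma smooth_coinduct:
  assumes "F \<in> S"
    and diff: "\<And>G x. G \<in> S \<Longrightarrow> G differentiable (at x)"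
    and closed: "\<And>G. G \<in> S \<Longrightarrow> mderiv G \<in> S"
  shows "smooth F"
proof -
  have "(mderiv ^^ n) F \<in> S" for n
    by (induction n) (use assms in auto)
  with diff show ?thesis by (simp add: smooth_def)
qed

lemma smooth_differentiable: "smooth F \<Longrightarrow> F differentiable (at x)"
  unfolding smooth_def by (metis funpow_0)

lemma smooth_mderiv: "smooth F \<Longrightarrow> smooth (mderiv F)"
  unfolding smooth_def by (metis comp_apply funpow_Suc_right)

lemma smooth_has_vector_derivative:
  "smooth F \<Longrightarrow> (F has_vector_derivative mderiv F x) (at x)"
  by (simp add: mderiv_def smooth_differentiable flip: vector_derivative_works)

lemma mderiv_eqI:
  "(\<And>x. (F has_vector_derivative G x) (at x)) \<Longrightarrow> mderiv F = G"
  by (auto simp: mderiv_def fun_eq_iff vector_derivative_at)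

lemma smooth_bounded_linear:
  fixes L :: "complex^'n^'n \<Rightarrow> complex^'n^'n"
  assumes L: "bounded_linear L" and F: "smooth F"
  shows "smooth (\<lambda>x. L (F x))"
proof (rule smooth_coinduct)
  let ?S = "{(\<lambda>x. L (G x)) | G. smooth G}"
  show "(\<lambda>x. L (F x)) \<in> ?S" using F by blast
  have deriv: "((\<lambda>x. L (G x)) has_vector_derivative L (mderiv G x)) (at x)" if "smooth G" for G x
    using smooth_has_vector_derivative[OF that] by (rule bounded_linear.has_vector_derivative[OF L])
  show "H differentiable (at x)" if "H \<in> ?S" for H x
    using that deriv differentiableI_vector by blast
  show "mderiv H \<in> ?S" if "H \<in> ?S" for H
    using that mderiv_eqI[OF deriv] smooth_mderiv by force
qed

text \<open>The coinduction class consists of all \<open>x G + H\<close> with smooth \<open>G\<close> and \<open>H\<close>, because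
  \<open>(x G + H)' = x G' + (G + H')\<close>.\<close>

lemma smooth_scaleR_id:
  fixes F :: "('n::finite) mfun"
  assumes "smooth F"
  shows "smooth (\<lambda>x. x *\<^sub>R F x)"
proof (rule smooth_coinduct)
  let ?S = "{(\<lambda>x. x *\<^sub>R G x + H x) | G H :: 'n mfun. smooth G \<and> smooth H}"
  show "(\<lambda>x. x *\<^sub>R F x) \<in> ?S"
    using assms smooth_zero by (intro CollectI exI[of _ F] exI[of _ 0]) auto
  have deriv: "((\<lambda>x. x *\<^sub>R G x + H x) has_vector_derivative
      x *\<^sub>R mderiv G x + (G + mderiv H) x) (at x)" if "smooth G" "smooth H" for G H :: "'n mfun" and x
    using smooth_has_vector_derivative[OF that(1)] smooth_has_vector_derivative[OF that(2)]
    by (auto intro!: derivative_eq_intros simp: algebra_simps)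
  show "K differentiable (at x)" if "K \<in> ?S" for K x
    using that deriv differentiableI_vector by blast
  show "mderiv K \<in> ?S" if K_in: "K \<in> ?S" for K
  proof -
    obtain G H where GH: "smooth G" "smooth H" and K: "K = (\<lambda>x. x *\<^sub>R G x + H x)"
      using K_in by auto
    have "mderiv K = (\<lambda>x. x *\<^sub>R mderiv G x + (G + mderiv H) x)"
      unfolding K by (rule mderiv_eqI) (rule deriv[OF GH])
    then show ?thesis
      using smooth_mderiv smooth_add GH by blast
  qed
qed

lemma smooth_const: "smooth (\<lambda>x. M)"
  by (rule smooth_coinduct[where S = "range (\<lambda>M x. M)"]) (auto simp: mderiv_def)

lemma bounded_linear_matrix_mult_right:
  "bounded_linear (\<lambda>M :: complex^'n^'n. M ** (A :: complex^'n^'n))"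
  by (rule linear_conv_bounded_linear[THEN iffD1], rule linearI)
    (simp_all add: matrix_matrix_mult_def vec_eq_iff sum.distrib scaleR_sum_right algebra_simps)

lemma bounded_bilinear_cmat_scale:
  "bounded_bilinear (cmat_scale :: complex \<Rightarrow> complex^'n^'n \<Rightarrow> complex^('n::finite)^'n)"
  by (subst bilinear_conv_bounded_bilinear[symmetric], unfold bilinear_def)
    (auto intro!: linearI
       simp: cmat_scale_def vec_eq_iff algebra_simps scaleR_conv_of_real[where 'a = complex])

text \<open>Horner's rule reduces multiplication by a polynomial to multiplication by constants
  and by \<open>x\<close>.\<close>

lemma smooth_poly_scale:
  fixes F :: "('n::finite) mfun"
  assumes "smooth F"
  shows "smooth (\<lambda>x. cmat_scale (poly p (of_real x)) (F x))"
proof (induction p)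
  case 0
  have "(\<lambda>x. cmat_scale (poly 0 (of_real x)) (F x)) = 0"
    by (simp add: cmat_scale_def fun_eq_iff vec_eq_iff)
  then show ?case by (simp add: smooth_zero)
next
  case (pCons a p)
  have "(\<lambda>x. cmat_scale (poly (pCons a p) (of_real x)) (F x)) =
      (\<lambda>x. cmat_scale a (F x)) + (\<lambda>x. x *\<^sub>R cmat_scale (poly p (of_real x)) (F x))"
    by (simp add: cmat_scale_def fun_eq_iff vec_eq_iff algebra_simps scaleR_conv_of_real[where 'a = complex])
  then show ?case
    by (simp add: smooth_add smooth_scale smooth_scaleR_id[OF pCons.IH] assms)
qed

lemma mderiv_poly_scale:
  fixes F :: "('n::finite) mfun"
  assumes "smooth F"
  shows "mderiv (\<lambda>x. cmat_scale (poly p (of_real x)) (F x)) =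
    (\<lambda>x. cmat_scale (poly p (of_real x)) (mderiv F x)
       + cmat_scale (poly (pderiv p) (of_real x)) (F x))"
proof (rule mderiv_eqI)
  fix x
  have "((\<lambda>x. poly p (of_real x)) has_vector_derivative poly (pderiv p) (of_real x)) (at x)"
    by (rule has_vector_derivative_real_field) (rule poly_DERIV)
  from bounded_bilinear.has_vector_derivative[OF bounded_bilinear_cmat_scale
      this smooth_has_vector_derivative[OF assms]]
  show "((\<lambda>x. cmat_scale (poly p (of_real x)) (F x)) has_vector_derivative
    cmat_scale (poly p (of_real x)) (mderiv F x)
       + cmat_scale (poly (pderiv p) (of_real x)) (F x)) (at x)" .
qed

section \<open>The operators and their brackets\<close>

lemma D_op_linear: "D_op A \<in> linear_operators"
proof -
  have "smooth (D_op A F)" if "smooth F" for F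
    using smooth_add[OF smooth_mderiv[OF that]
        smooth_bounded_linear[OF bounded_linear_matrix_mult_right[of A] that]] that
    by (simp add: D_op_def plus_fun_def)
  moreover have "D_op A (F + G) = D_op A F + D_op A G" if "smooth F" "smooth G" for F G
    using that mderiv_add[of F G, OF smooth_differentiable smooth_differentiable] smooth_add[OF that]
    by (simp add: D_op_def plus_fun_def fun_eq_iff vec_eq_iff matrix_matrix_mult_def
        sum.distrib algebra_simps)
  moreover have "D_op A (\<lambda>x. cmat_scale c (F x)) = (\<lambda>x. cmat_scale c (D_op A F x))"
    if "smooth F" for c F
    using that mderiv_scale[of F c, OF smooth_differentiable] smooth_scale[OF that]
    by (simp add: D_op_def cmat_scale_def vec_eq_iff fun_eq_iff matrix_matrix_mult_def
        sum_distrib_left algebra_simps)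
  moreover have "D_op A F = 0" if "\<not> smooth F" for F
    using that by (simp add: D_op_def)
  ultimately show ?thesis
    by (simp add: linear_operators_def)
qed

lemma poly_op_linear: "(poly_op p :: ('n::finite) mop) \<in> linear_operators"
proof -
  have "poly_op p (F + G) = poly_op p F + poly_op p G" if "smooth F" "smooth G" for F G :: "'n mfun"
    using that smooth_add[OF that]
    by (simp add: poly_op_def cmat_scale_def vec_eq_iff fun_eq_iff algebra_simps)
  moreover have "poly_op p (\<lambda>x. cmat_scale c (F x)) = (\<lambda>x. cmat_scale c (poly_op p F x))"
    if "smooth F" for c and F :: "'n mfun"
    using that smooth_scale[OF that]
    by (simp add: poly_op_def cmat_scale_def vec_eq_iff fun_eq_iff algebra_simps)
  moreover have "smooth (poly_op p F)" if "smooth F" for F :: "'n mfun"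
    using that by (simp add: poly_op_def smooth_poly_scale)
  moreover have "poly_op p F = 0" if "\<not> smooth F" for F :: "'n mfun"
    using that by (simp add: poly_op_def)
  ultimately show ?thesis
    by (simp add: linear_operators_def)
qed

lemma poly_op_0: "poly_op 0 = 0"
  by (simp add: poly_op_def cmat_scale_def vec_eq_iff fun_eq_iff)

lemma poly_op_add: "poly_op (p + q) = poly_op p + poly_op q"
  by (simp add: poly_op_def cmat_scale_def vec_eq_iff fun_eq_iff algebra_simps)

lemma poly_op_smult: "poly_op (smult c p) = op_scale c (poly_op p)"
  by (simp add: poly_op_def op_scale_def cmat_scale_def vec_eq_iff fun_eq_iff algebra_simps)

lemma op_scale_linear:
  assumes "T \<in> linear_operators" shows "op_scale c T \<in> linear_operators"
proof -
  note T = linear_operatorsD[OF assms]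
  have "op_scale c T (\<lambda>x. cmat_scale d (F x)) = (\<lambda>x. cmat_scale d (op_scale c T F x))"
    if "smooth F" for d F
    using T(5)[OF that] by (simp add: op_scale_def cmat_scale_def fun_eq_iff vec_eq_iff)
  moreover have "op_scale c T (F + G) = op_scale c T F + op_scale c T G"
    if "smooth F" "smooth G" for F G
    using T(3)[OF that] by (simp add: op_scale_def cmat_scale_def fun_eq_iff vec_eq_iff algebra_simps)
  moreover have "op_scale c T F = 0" if "\<not> smooth F" for F
    using T(2)[OF that] by (simp add: op_scale_def cmat_scale_def fun_eq_iff vec_eq_iff)
  moreover have "smooth (op_scale c T F)" for F
    using smooth_scale[OF T(1)] by (simp add: op_scale_def)
  ultimately show ?thesis by (simp add: linear_operators_def)
qed

lemma add_linear:
  assumes "S \<in> linear_operators" "T \<in> linear_operators" shows "S + T \<in> linear_operators"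
proof -
  note S = linear_operatorsD[OF assms(1)] and T = linear_operatorsD[OF assms(2)]
  have scale: "(\<lambda>x. cmat_scale c (F x)) + (\<lambda>x. cmat_scale c (G x)) = (\<lambda>x. cmat_scale c (F x + G x))"
    for c and F G :: "'a mfun"
    by (simp add: fun_eq_iff cmat_scale_def vec_eq_iff algebra_simps)
  show ?thesis
    using S T by (simp add: linear_operators_def smooth_add scale)
qed

text \<open>As operators act from the right, \<open>F \<cdot> [\<D>, p] = p (F' + F A) - ((p F)' + p F A) = - p' F\<close>:
  the matrix \<open>A\<close> cancels, and the sign is opposite to that for left actions.\<close>

lemma commutator_D_poly:
  fixes A :: "complex^'a^'a"
  shows "commutator (D_op A) (poly_op p) = poly_op (- pderiv p)"
proof
  fix F :: "'a mfun"
  have mult: "cmat_scale c M ** A = cmat_scale c (M ** A)" for c and M :: "complex^'a^'a"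
    by (simp add: cmat_scale_def vec_eq_iff matrix_matrix_mult_def sum_distrib_left algebra_simps)
  have sm: "smooth (D_op A F)" "smooth (poly_op p F)"
    using D_op_linear poly_op_linear linear_operatorsD(1) by blast+
  show "commutator (D_op A) (poly_op p) F = poly_op (- pderiv p) F"
  proof (cases "smooth F")
    case True
    then show ?thesis
      using sm mderiv_poly_scale[OF True, of p]
      by (simp add: commutator_def op_prod_def poly_op_def D_op_def fun_eq_iff mult)
        (simp add: cmat_scale_def vec_eq_iff algebra_simps)
  next
    case False
    then have "D_op A F = 0" "D_op A (0 :: 'a mfun) = 0"
        "poly_op q F = 0" "poly_op q (0 :: 'a mfun) = 0" for q
      using linear_operatorsD(2,6) D_op_linear poly_op_linear by blast+
    then show ?thesis
      by (simp add: commutator_def op_prod_def)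
  qed
qed

lemma commutator_poly_poly: "commutator (poly_op p) (poly_op q) = 0"
proof
  fix F
  show "commutator (poly_op p) (poly_op q) F = 0 F"
    by (cases "smooth F")
      (auto simp: commutator_def op_prod_def poly_op_def smooth_poly_scale,
       auto simp: cmat_scale_def vec_eq_iff fun_eq_iff)
qed

lemma commutator_D_poly_combination:
  "commutator (op_scale c (D_op A) + poly_op p) (op_scale d (D_op A) + poly_op q)
     = poly_op (smult d (pderiv p) - smult c (pderiv q))"
proof -
  let ?D = "D_op A"
  note lin = D_op_linear poly_op_linear op_scale_linear[OF D_op_linear]
    add_linear[OF op_scale_linear[OF D_op_linear] poly_op_linear]
  have left: "commutator (op_scale c ?D + poly_op p) T
      = op_scale c (commutator ?D T) + commutator (poly_op p) T"
    if "T \<in> linear_operators" for T c p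
    using that by (simp add: commutator_add_left commutator_scale_left lin)
  have "commutator ?D (op_scale d ?D + poly_op q) = poly_op (- pderiv q)"
    using left[OF lin(1), of d q] commutator_antisym[of ?D "op_scale d ?D + poly_op q"]
      commutator_antisym[of "poly_op q" ?D]
    by (simp add: commutator_self commutator_D_poly)
  moreover have "commutator (poly_op p) (op_scale d ?D + poly_op q)
      = op_scale d (poly_op (pderiv p))"
    using left[OF lin(2), of d q p] commutator_antisym[of "poly_op p" "op_scale d ?D + poly_op q"]
    by (simp add: commutator_poly_poly commutator_D_poly flip: poly_op_smult)
      (simp add: poly_op_def fun_eq_iff cmat_scale_def vec_eq_iff)
  ultimately show ?thesis
    using left[OF lin(4)]
    by (simp flip: poly_op_smult poly_op_add)
qed

section \<open>The generated Lie algebra\<close>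

text \<open>The polynomials of degree less than \<open>m\<close>; the condition on coefficients includes the zero
  polynomial also for \<open>m = 0\<close>, although its \<open>degree\<close> is \<open>0\<close>.\<close>

definition polys_below :: "nat \<Rightarrow> complex poly set" where
  "polys_below m = {p. \<forall>i\<ge>m. coeff p i = 0}"

text \<open>The Lie algebra \<open>\<complex> \<D> + P\<^sub>m\<close>.\<close>

definition D_poly_algebra :: "complex^'n^'n \<Rightarrow> nat \<Rightarrow> ('n::finite) mop set" where
  "D_poly_algebra A m = {op_scale c (D_op A) + poly_op p | c p. p \<in> polys_below m}"

lemma polys_below_closed:
  "0 \<in> polys_below m"
  "p \<in> polys_below m \<Longrightarrow> q \<in> polys_below m \<Longrightarrow> p + q \<in> polys_below m"
  "p \<in> polys_below m \<Longrightarrow> q \<in> polys_below m \<Longrightarrow> p - q \<in> polys_below m"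
  "p \<in> polys_below m \<Longrightarrow> smult c p \<in> polys_below m"
  "p \<in> polys_below m \<Longrightarrow> pderiv p \<in> polys_below m"
  by (auto simp: polys_below_def coeff_pderiv)

lemma pderiv_in_polys_below: "pderiv v \<in> polys_below (degree v)"
  by (auto simp: polys_below_def coeff_pderiv coeff_eq_0)

lemma subspace_D_poly_algebra: "mop_subspace (D_poly_algebra A m)"
proof (rule mop.subspaceI)
  show "0 \<in> D_poly_algebra A m"
    unfolding D_poly_algebra_def using polys_below_closed(1)
    by (auto intro!: exI[of _ 0] simp: poly_op_0)
  fix S T assume "S \<in> D_poly_algebra A m" "T \<in> D_poly_algebra A m"
  then obtain c p d q where S: "S = op_scale c (D_op A) + poly_op p" "p \<in> polys_below m"
    and T: "T = op_scale d (D_op A) + poly_op q" "q \<in> polys_below m"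
    by (auto simp: D_poly_algebra_def)
  have "S + T = op_scale (c + d) (D_op A) + poly_op (p + q)"
    by (simp add: S T mop.scale_left_distrib poly_op_add)
  then show "S + T \<in> D_poly_algebra A m"
    unfolding D_poly_algebra_def using S(2) T(2) polys_below_closed(2) by blast
next
  fix c T assume "T \<in> D_poly_algebra A m"
  then obtain d q where T: "T = op_scale d (D_op A) + poly_op q" "q \<in> polys_below m"
    by (auto simp: D_poly_algebra_def)
  have "op_scale c T = op_scale (c * d) (D_op A) + poly_op (smult c q)"
    by (simp add: T mop.scale_right_distrib poly_op_smult)
  then show "op_scale c T \<in> D_poly_algebra A m"
    unfolding D_poly_algebra_def using T(2) polys_below_closed(4) by blast
qed

lemma poly_op_in_D_poly_algebra: "p \<in> polys_below m \<Longrightarrow> poly_op p \<in> D_poly_algebra A m"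
  unfolding D_poly_algebra_def by (auto intro!: exI[of _ 0] exI[of _ p])

lemma D_op_in_D_poly_algebra: "D_op A \<in> D_poly_algebra A m"
  unfolding D_poly_algebra_def using polys_below_closed(1)
  by (intro CollectI exI[of _ 1] exI[of _ 0]) (simp add: poly_op_0)

lemma lie_subalgebra_D_poly_algebra: "lie_subalgebra (D_poly_algebra A m)"
  unfolding lie_subalgebra_def
proof (intro conjI ballI)
  show "D_poly_algebra A m \<subseteq> linear_operators"
    by (auto simp: D_poly_algebra_def intro!: add_linear op_scale_linear D_op_linear poly_op_linear)
  show "commutator S T \<in> D_poly_algebra A m"
    if ST: "S \<in> D_poly_algebra A m" "T \<in> D_poly_algebra A m" for S T
  proof -
    obtain c p d q where "S = op_scale c (D_op A) + poly_op p" "p \<in> polys_below m"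
      "T = op_scale d (D_op A) + poly_op q" "q \<in> polys_below m"
      using ST by (auto simp: D_poly_algebra_def)
    then show ?thesis
      by (simp add: commutator_D_poly_combination poly_op_in_D_poly_algebra polys_below_closed)
  qed
qed (rule subspace_D_poly_algebra)

text \<open>A space of polynomials stable under differentiation contains, with a polynomial \<open>q\<close> of
  degree \<open>n\<close>, polynomials of every degree from \<open>0\<close> to \<open>n\<close>. Subtracting a multiple of \<open>q\<close> kills the
  coefficient of degree \<open>n\<close> and leaves the claim for \<open>q'\<close>, which has degree \<open>n - 1\<close>.\<close>

lemma mem_if_pderiv_closed:
  fixes p q :: "'a::field_char_0 poly"
  assumes add: "\<And>p q. p \<in> Q \<Longrightarrow> q \<in> Q \<Longrightarrow> p + q \<in> Q"
    and smult: "\<And>c p. p \<in> Q \<Longrightarrow> smult c p \<in> Q"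
    and pderiv: "\<And>p. p \<in> Q \<Longrightarrow> pderiv p \<in> Q"
    and "q \<in> Q" "q \<noteq> 0" "degree p \<le> degree q"
  shows "p \<in> Q"
  using assms(4-6)
proof (induction "degree q" arbitrary: p q)
  case 0
  then obtain a b where ab: "p = [:a:]" "q = [:b:]"
    by (metis le_zero_eq degree_eq_zeroE)
  with 0 have "p = smult (a / b) q" by simp
  with 0 smult show ?case by metis
next
  case (Suc n)
  let ?c = "coeff p (Suc n) / coeff q (Suc n)"
  have lead: "coeff q (Suc n) \<noteq> 0"
    using Suc by (metis leading_coeff_0_iff)
  have "degree (p - smult ?c q) \<le> n"
  proof (rule degree_le, intro allI impI)
    fix i assume "n < i"
    then consider "i = Suc n" | "Suc n < i" by linarith
    then show "coeff (p - smult ?c q) i = 0"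
      using lead Suc.prems Suc.hyps by cases (auto simp: coeff_eq_0)
  qed
  moreover have "degree (pderiv q) = n" "pderiv q \<noteq> 0"
    using Suc.hyps(2) by (auto simp: degree_pderiv pderiv_eq_0_iff)
  ultimately have "p - smult ?c q \<in> Q"
    using Suc.hyps(1)[of "pderiv q"] pderiv[OF Suc.prems(1)] by simp
  from add[OF this smult[OF Suc.prems(1), of ?c]] show ?case by simp
qed

text \<open>The polynomials whose operators lie in \<open>L\<close> form a space that contains \<open>v'\<close>, since
  \<open>\<D> + \<D>\<^sup>\<dagger> = v'\<close>, and is stable under differentiation, since \<open>[\<D>, p] = - p'\<close>.\<close>

lemma D_poly_algebra_least:
  assumes L: "lie_subalgebra L" and D: "D_op A \<in> L" "D_dagger A v \<in> L"
  shows "D_poly_algebra A (degree v) \<subseteq> L"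
proof -
  let ?Q = "{p. poly_op p \<in> L}"
  have sub: "mop_subspace L" and comm: "\<And>S T. S \<in> L \<Longrightarrow> T \<in> L \<Longrightarrow> commutator S T \<in> L"
    using L by (auto simp: lie_subalgebra_def)
  have smult: "smult c p \<in> ?Q" if "p \<in> ?Q" for c p
    using that mop.subspace_scale[OF sub] by (simp add: poly_op_smult)
  have add: "p + q \<in> ?Q" if "p \<in> ?Q" "q \<in> ?Q" for p q
    using that mop.subspace_add[OF sub] by (simp add: poly_op_add)
  have pderiv: "pderiv p \<in> ?Q" if "p \<in> ?Q" for p
  proof -
    have "- pderiv p \<in> ?Q"
      using comm[OF D(1), of "poly_op p"] that by (simp add: commutator_D_poly)
    from smult[OF this, of "-1"] show ?thesis by simp
  qed
  have v': "pderiv v \<in> ?Q"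
    using mop.subspace_add[OF sub D] by (simp add: D_dagger_def)
  have "polys_below (degree v) \<subseteq> ?Q"
  proof (cases "degree v = 0")
    case True
    then have "polys_below (degree v) = {0}" by (auto simp: polys_below_def poly_eq_iff)
    then show ?thesis using mop.subspace_0[OF sub] by (simp add: poly_op_0)
  next
    case False
    show ?thesis
    proof
      fix p assume "p \<in> polys_below (degree v)"
      then have "degree p \<le> degree (pderiv v)"
        using False by (auto simp: polys_below_def degree_pderiv intro!: degree_le)
      moreover have "pderiv v \<noteq> 0" using False by (simp add: pderiv_eq_0_iff)
      ultimately show "p \<in> ?Q"
        using mem_if_pderiv_closed[of ?Q "pderiv v" p] add smult pderiv v' by blast
    qed
  qed
  then show ?thesis
    using mop.subspace_add[OF sub] mop.subspace_scale[OF sub] D(1)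
    by (auto simp: D_poly_algebra_def)
qed

lemma lie_generated_eq:
  "lie_generated {D_op A, D_dagger A v} = D_poly_algebra A (degree v)"
proof -
  have "D_dagger A v = op_scale (-1) (D_op A) + poly_op (pderiv v)"
    by (simp add: D_dagger_def)
  then have "D_dagger A v \<in> D_poly_algebra A (degree v)"
    using pderiv_in_polys_below unfolding D_poly_algebra_def by blast
  then have "{D_op A, D_dagger A v} \<subseteq> D_poly_algebra A (degree v)"
    by (simp add: D_op_in_D_poly_algebra)
  then show ?thesis
    unfolding lie_generated_def
    by (intro equalityI Inter_lower Inter_greatest CollectI conjI lie_subalgebra_D_poly_algebra)
      (auto dest: D_poly_algebra_least)
qed

section \<open>Its dimension\<close>

text \<open>The identity matrix alone gives \<open>c A + p I = 0\<close>, which does not exclude \<open>c \<noteq> 0\<close> when \<open>A\<close> is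
  scalar. The test function \<open>x I\<close> detects the derivative in \<open>\<D>\<close>.\<close>

lemma D_op_poly_op_independent:
  fixes A :: "complex^'n^'n"
  assumes "op_scale c (D_op A) + poly_op p = 0"
  shows "c = 0 \<and> p = 0"
proof -
  \<comment> \<open>One diagonal entry of the matrices suffices.\<close>
  fix i :: 'n
  let ?I = "mat 1 :: complex^'n^'n"
  have zero: "cmat_scale c (D_op A F x) + poly_op p F x = 0" for F x
    using fun_cong[OF fun_cong[OF assms], of F x] by (simp add: op_scale_def)
  have "mderiv (\<lambda>x. ?I) = (\<lambda>x. 0)"
    by (simp add: mderiv_def)
  then have const: "c * A $ i $ i + poly p (of_real x) = 0" for x :: real
    using zero[of "\<lambda>x. ?I" x]
    by (simp add: D_op_def poly_op_def smooth_const cmat_scale_def vec_eq_iff)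
      (auto dest!: spec[of _ i] simp: mat_def)
  have "mderiv (\<lambda>x. x *\<^sub>R ?I) = (\<lambda>x. ?I)"
    by (rule mderiv_eqI) (auto intro!: derivative_eq_intros)
  then have id: "c * (1 + of_real x * A $ i $ i) + poly p (of_real x) * of_real x = 0" for x :: real
    using zero[of "\<lambda>x. x *\<^sub>R ?I" x]
    by (simp add: D_op_def poly_op_def smooth_scaleR_id[OF smooth_const] cmat_scale_def vec_eq_iff
        matrix_matrix_mult_def)
      (auto dest!: spec[of _ i] simp: mat_def if_distrib if_distribR mult.commute
          scaleR_conv_of_real[where 'a = complex] cong: if_cong)
  \<comment> \<open>Subtracting \<open>x\<close> times the first relation from the second leaves \<open>c = 0\<close>; here \<open>x = 1\<close>.\<close>
  have c: "c = 0"
    using id[of 1] const[of 1] by (simp add: algebra_simps)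
  have "range (of_real :: real \<Rightarrow> complex) \<subseteq> {z. poly p z = 0}"
    using const c by auto
  moreover have "infinite (range (of_real :: real \<Rightarrow> complex))"
    by (simp add: finite_image_iff inj_of_real infinite_UNIV_char_0)
  ultimately have "infinite {z. poly p z = 0}"
    using finite_subset by blast
  with poly_roots_finite c show ?thesis by blast
qed

lemma inj_poly_op: "inj (poly_op :: complex poly \<Rightarrow> ('n::finite) mop)"
proof (rule injI)
  fix p q :: "complex poly"
  assume eq: "(poly_op p :: 'n mop) = poly_op q"
  have "op_scale 0 (D_op (0 :: complex^'n^'n)) + poly_op (p + smult (-1) q) = 0"
    unfolding poly_op_add poly_op_smult eq by simp
  from D_op_poly_op_independent[OF this] show "p = q" by simp
qed

text \<open>The dimension is read off the explicit basis of \<open>\<D>\<close> and the monomials \<open>1, x, \<dots>, x\<^bsup>m-1\<^esup>\<close>.\<close>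

lemma span_poly_op_monom:
  "mop_span ((\<lambda>i. poly_op (monom 1 i) :: ('n::finite) mop) ` {..<m}) = poly_op ` polys_below m"
proof (induction m)
  case 0
  have "polys_below 0 = {0}" by (auto simp: polys_below_def poly_eq_iff)
  then show ?case using poly_op_0 by simp
next
  case (Suc m)
  let ?b = "\<lambda>i. poly_op (monom 1 i) :: 'n mop"
  have insert: "T \<in> mop_span (?b ` {..<Suc m}) \<longleftrightarrow>
      (\<exists>c. T - op_scale c (?b m) \<in> poly_op ` polys_below m)" for T
    by (simp only: lessThan_Suc image_insert mop.span_insert Suc.IH mem_Collect_eq)
  show ?case
  proof (intro equalityI subsetI)
    fix T assume "T \<in> mop_span (?b ` {..<Suc m})"
    then obtain c p where p: "p \<in> polys_below m" "T - op_scale c (?b m) = poly_op p"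
      unfolding insert by blast
    then have "T = poly_op (p + smult c (monom 1 m))"
      by (simp add: poly_op_add poly_op_smult flip: p(2) del: smult_monom)
    moreover have "p + smult c (monom 1 m) \<in> polys_below (Suc m)"
      using p by (simp add: polys_below_def)
    ultimately show "T \<in> poly_op ` polys_below (Suc m)" by blast
  next
    fix T :: "'n mop" assume "T \<in> poly_op ` polys_below (Suc m)"
    then obtain p where p: "p \<in> polys_below (Suc m)" "T = poly_op p" by blast
    define r where "r = p - smult (coeff p m) (monom 1 m)"
    have "r \<in> polys_below m"
      unfolding polys_below_def
    proof (intro CollectI allI impI)
      fix i assume "m \<le> i"
      then show "coeff r i = 0"
        using p(1) by (cases "i = m") (simp_all add: r_def polys_below_def)
    qed
    moreover have "p = r + smult (coeff p m) (monom 1 m)" by (simp add: r_def)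
    then have "T - op_scale (coeff p m) (?b m) = poly_op r"
      using p by (metis add_diff_cancel_right' poly_op_add poly_op_smult)
    ultimately show "T \<in> mop_span (?b ` {..<Suc m})"
      unfolding insert by blast
  qed
qed

lemma independent_poly_op_monom:
  "\<not> mop_dependent ((\<lambda>i. poly_op (monom 1 i) :: ('n::finite) mop) ` {..<m})"
proof (induction m)
  case 0
  show ?case using mop.independent_empty by simp
next
  case (Suc m)
  let ?b = "\<lambda>i. poly_op (monom 1 i) :: 'n mop"
  have "?b m \<notin> mop_span (?b ` {..<m})"
  proof
    assume "?b m \<in> mop_span (?b ` {..<m})"
    then obtain q where q: "q \<in> polys_below m" "?b m = poly_op q"
      unfolding span_poly_op_monom by blast
    then have "monom 1 m = q" by (simp add: inj_poly_op[THEN injD])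
    with q show False by (auto simp: polys_below_def)
  qed
  then show ?case
    using mop.independent_insertI[OF _ Suc.IH] by (simp only: lessThan_Suc image_insert)
qed

lemma dim_D_poly_algebra:
  fixes A :: "complex^'n^'n"
  shows "mop_dim (D_poly_algebra A m) = m + 1"
proof -
  let ?b = "\<lambda>i. poly_op (monom 1 i) :: 'n mop"
  have new: "D_op A \<notin> mop_span (?b ` {..<m})"
  proof
    assume "D_op A \<in> mop_span (?b ` {..<m})"
    then obtain p where p: "D_op A = poly_op p" unfolding span_poly_op_monom by blast
    have "op_scale 1 (D_op A) + poly_op (smult (-1) p) = 0"
      unfolding poly_op_smult p by simp
    with D_op_poly_op_independent show False by fastforce
  qed
  have "inj ?b"
  proof (rule injI)
    fix i j assume "?b i = ?b j"
    then have "monom (1 :: complex) i = monom 1 j" by (rule injD[OF inj_poly_op])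
    then show "i = j" by (simp add: monom_eq_iff')
  qed
  then have card: "card (?b ` {..<m}) = m"
    by (simp add: card_image inj_on_subset)
  have "T \<in> mop_span (insert (D_op A) (?b ` {..<m})) \<longleftrightarrow> T \<in> D_poly_algebra A m" for T
  proof -
    have "T \<in> mop_span (insert (D_op A) (?b ` {..<m}))
        \<longleftrightarrow> (\<exists>c. \<exists>p\<in>polys_below m. T - op_scale c (D_op A) = poly_op p)"
      unfolding mop.span_insert span_poly_op_monom by blast
    also have "\<dots> \<longleftrightarrow> T \<in> D_poly_algebra A m"
      unfolding D_poly_algebra_def diff_eq_eq add.commute[of "op_scale _ _"] by blast
    finally show ?thesis .
  qed
  then have span: "mop_span (insert (D_op A) (?b ` {..<m})) = D_poly_algebra A m"
    by blast
  have "\<not> mop_dependent (insert (D_op A) (?b ` {..<m}))"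
    by (rule mop.independent_insertI[OF new independent_poly_op_monom])
  then have "mop_dim (D_poly_algebra A m) = card (insert (D_op A) (?b ` {..<m}))"
    unfolding span[symmetric] mop.dim_span by (rule mop.dim_eq_card_independent)
  moreover have "D_op A \<notin> ?b ` {..<m}"
    using new by (rule contrapos_nn) (rule mop.span_base)
  ultimately show ?thesis
    by (simp add: card)
qed

theorem proposition3p4:
  fixes A :: "complex^'n^'n" and v :: "complex poly" and k :: nat
  assumes "degree v = k"
  shows "lie_subalgebra (lie_generated {D_op A, D_dagger A v})
       \<and> mop_dim (lie_generated {D_op A, D_dagger A v}) = k + 1"
  using assms by (simp add: lie_generated_eq lie_subalgebra_D_poly_algebra dim_D_poly_algebra)

end
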